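(* Let $n \ge 1$. Every Threshold-of-ANDs circuit (with the size convention described in the context) computing the inner product function $\mathrm{IP}(x_1,\ldots,x_n,y_1,\ldots,y_n) = \sum_{i=1}^n x_i y_i \bmod 2$ on $\{0,1\}^n \times \{0,1\}^n$ has size at least $2^n$.
   Context: A Threshold-of-ANDs circuit on Boolean inputs $z_1,\ldots,z_N$ consists of AND gates $g_1,\ldots,g_s$, each computing the conjunction of a set of literals from $\{z_1,\ldots,z_N,\neg z_1,\ldots,\neg z_N\}$ (an AND gate with an empty set of literals computes the constant $1$), feeding a single top threshold gate with real weights $w_1,\ldots,w_s$ and no constant term: the circuit outputs $1$ if $\sum_{t} w_t g_t(z) < 0$ and $0$ if $\sum_t w_t g_t(z) > 0$, where it is required that $\sum_t w_t g_t(z) \neq 0$ for every input $z$. The size of the circuit is the number $s$ of AND gates. Here the inputs are $x_1,\ldots,x_n,y_1,\ldots,y_n$. *)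

theory Defs
  imports Complex_Main
begin

datatype 'v literal = Pos 'v | Neg 'v

primrec eval_literal :: "('v \<Rightarrow> bool) \<Rightarrow> 'v literal \<Rightarrow> bool" where
  "eval_literal z (Pos v) = z v"
| "eval_literal z (Neg v) = (\<not> z v)"

definition literals :: "'v set \<Rightarrow> 'v literal set" where
  "literals V = Pos ` V \<union> Neg ` V"

definition and_gate :: "'v literal set \<Rightarrow> ('v \<Rightarrow> bool) \<Rightarrow> bool" where
  "and_gate L z \<longleftrightarrow> (\<forall>l\<in>L. eval_literal z l)"

text \<open>
  A circuit is the list of pairs (w_t, L_t), t = 1, ..., s, of the top-gate weight and the
  literal set of each AND gate. Repeated gates are allowed and are counted with multiplicity.
\<close>

type_synonym 'v threshold_of_ands = "(real \<times> 'v literal set) list"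

definition circuit_size :: "'v threshold_of_ands \<Rightarrow> nat" where
  "circuit_size C = length C"

definition weighted_sum :: "'v threshold_of_ands \<Rightarrow> ('v \<Rightarrow> bool) \<Rightarrow> real" where
  "weighted_sum C z = (\<Sum>(w, L)\<leftarrow>C. w * of_bool (and_gate L z))"

text \<open>
  Inputs are total assignments \<open>z\<close>; a circuit on the variables \<open>V\<close> only reads \<open>z\<close> on \<open>V\<close>, so
  quantifying over all \<open>z\<close> amounts to quantifying over the points of the cube indexed by \<open>V\<close>.
\<close>

definition is_circuit :: "'v set \<Rightarrow> 'v threshold_of_ands \<Rightarrow> bool" where
  "is_circuit V C \<longleftrightarrow>
     (\<forall>(w, L)\<in>set C. L \<subseteq> literals V) \<and> (\<forall>z. weighted_sum C z \<noteq> 0)"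

definition circuit_output :: "'v threshold_of_ands \<Rightarrow> ('v \<Rightarrow> bool) \<Rightarrow> nat" where
  "circuit_output C z = (if weighted_sum C z < 0 then 1 else 0)"

definition computes :: "'v threshold_of_ands \<Rightarrow> (('v \<Rightarrow> bool) \<Rightarrow> nat) \<Rightarrow> bool" where
  "computes C f \<longleftrightarrow> (\<forall>z. circuit_output C z = f z)"

datatype xy_var = X nat | Y nat

definition xy_vars :: "nat \<Rightarrow> xy_var set" where
  "xy_vars n = X ` {1..n} \<union> Y ` {1..n}"

definition IP :: "nat \<Rightarrow> (xy_var \<Rightarrow> bool) \<Rightarrow> nat" where
  "IP n z = (\<Sum>i=1..n. of_bool (z (X i)) * of_bool (z (Y i))) mod 2"

end

theory Submission
  imports Defs
begin

text \<open>
  Induction on \<open>n\<close>. Let \<open>P\<close> be the weighted sum of a circuit for \<open>n + 1\<close>, and let \<open>P\<^sub>a\<^sub>b\<close> be its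
  restriction to \<open>(x\<^bsub>n+1\<^esub>, y\<^bsub>n+1\<^esub>) = (a, b)\<close>. Each of the four combinations \<open>P\<^sub>0\<^sub>1\<close>, \<open>P\<^sub>1\<^sub>0\<close>,
  \<open>P\<^sub>0\<^sub>1 - P\<^sub>1\<^sub>1\<close> and \<open>P\<^sub>1\<^sub>0 - P\<^sub>1\<^sub>1\<close> represents the sign of inner product on \<open>n\<close> pairs, so it involves at
  least \<open>2^n\<close> gates. An AND gate restricts \<open>(x\<^bsub>n+1\<^esub>, y\<^bsub>n+1\<^esub>)\<close> to a subcube of the square, and a
  subcube containing both \<open>01\<close> and \<open>10\<close> is the whole square; hence each gate survives
  in at most two of the four combinations, and the circuit has at least \<open>4 * 2^n / 2\<close> gates.
\<close>

definition sign_represents_IP :: "nat \<Rightarrow> xy_var threshold_of_ands \<Rightarrow> bool" where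
  "sign_represents_IP n C \<longleftrightarrow> (\<forall>z. (- 1) ^ IP n z * weighted_sum C z > 0)"

text \<open>\<open>c\<close> absorbs what a gate contributes on the fixed variables
  \<open>V\<close>, so restrictions and their differences are again circuits; the filter drops
  cancelled gates, so that \<open>length\<close> counts the survivors.\<close>

definition reweight ::
    "'v set \<Rightarrow> ('v literal set \<Rightarrow> real) \<Rightarrow> 'v threshold_of_ands \<Rightarrow> 'v threshold_of_ands" where
  "reweight V c C =
     map (\<lambda>(w, L). (c L * w, L - literals V)) (filter (\<lambda>(w, L). c L \<noteq> 0) C)"

definition gate_at :: "'v set \<Rightarrow> ('v \<Rightarrow> bool) \<Rightarrow> 'v literal set \<Rightarrow> real" where
  "gate_at V u L = of_bool (and_gate (L \<inter> literals V) u)"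

fun const_xy :: "bool \<Rightarrow> bool \<Rightarrow> xy_var \<Rightarrow> bool" where
  "const_xy a b (X i) = a"
| "const_xy a b (Y i) = b"

lemma eval_literal_override_on:
  "eval_literal (override_on z u V) l = eval_literal (if l \<in> literals V then u else z) l"
  by (cases l) (auto simp: literals_def override_on_def)

lemma and_gate_override_on:
  "and_gate L (override_on z u V) \<longleftrightarrow>
     and_gate (L \<inter> literals V) u \<and> and_gate (L - literals V) z"
  unfolding and_gate_def eval_literal_override_on by auto

lemma weighted_sum_override_on:
  "weighted_sum C (override_on z u V) = weighted_sum (reweight V (gate_at V u) C) z"
  by (induction C)
    (auto simp: weighted_sum_def reweight_def gate_at_def and_gate_override_on)

lemma weighted_sum_reweight_diff:
  "weighted_sum (reweight V (\<lambda>L. c L - d L) C) z =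
     weighted_sum (reweight V c C) z - weighted_sum (reweight V d C) z"
proof -
  have *: "weighted_sum (reweight V c C) z =
      (\<Sum>(w, L)\<leftarrow>C. c L * w * of_bool (and_gate (L - literals V) z))" for c
    by (induction C) (auto simp: weighted_sum_def reweight_def)
  show ?thesis
    unfolding * by (induction C) (auto simp: algebra_simps)
qed

text \<open>A literal reads a single variable, and the two assignments differ at every
  variable.\<close>

lemma and_gate_antipodal:
  assumes "and_gate L (const_xy False True)" "and_gate L (const_xy True False)"
  shows "L = {}"
proof -
  have "\<not> (eval_literal (const_xy False True) l \<and> eval_literal (const_xy True False) l)" for l
    by (cases l rule: literal.exhaust; rename_tac v; case_tac v) auto
  with assms show ?thesis
    unfolding and_gate_def by blast
qed

lemma IP_Suc_override_on:
  "(- 1 :: real) ^ IP (Suc n) (override_on z (const_xy a b) {X (Suc n), Y (Suc n)}) =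
     (if a \<and> b then - 1 else 1) * (- 1) ^ IP n z"
proof -
  have parity: "(- 1 :: real) ^ (k mod 2) = (- 1) ^ k" for k :: nat
    by (cases "even k") (auto simp: odd_iff_mod_2_eq_one)
  show ?thesis
    by (simp add: IP_def parity override_on_def power_add)
qed

text \<open>Gate by gate: with values p, q, r in {0, 1} at 01, 10, 11, at most two of p, q, p - r, q
  - r are nonzero, since p = q = 1 forces r = 1.\<close>

lemma length_reweight_sum_le:
  fixes V C
  defines "e \<equiv> \<lambda>a b. gate_at V (const_xy a b)"
  shows "length (reweight V (e False True) C) + length (reweight V (e True False) C)
       + length (reweight V (\<lambda>L. e False True L - e True True L) C)
       + length (reweight V (\<lambda>L. e True False L - e True True L) C) \<le> 2 * length C"
proof (induction C)
  case Nil
  then show ?case by (simp add: reweight_def)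
next
  case (Cons g C)
  obtain w L where g: "g = (w, L)" by fastforce
  have cube: "e True True L = 1" if "e False True L = 1" "e True False L = 1"
    using that and_gate_antipodal[of "L \<inter> literals V"]
    by (auto simp: e_def gate_at_def and_gate_def)
  have "e a b L = 0 \<or> e a b L = 1" for a b
    by (simp add: e_def gate_at_def)
  then have vals: "e False True L = 0 \<or> e False True L = 1"
      "e True False L = 0 \<or> e True False L = 1" "e True True L = 0 \<or> e True True L = 1"
    by blast+
  show ?case
    using vals
    by (elim disjE) (use Cons.IH cube in \<open>simp_all add: reweight_def g\<close>)
qed

lemma sign_represents_IP_length:
  "sign_represents_IP n C \<Longrightarrow> 2 ^ n \<le> length C"
proof (induction n arbitrary: C)
  \<comment> \<open>The empty circuit has sum 0, which is not positive.\<close>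
  case 0
  then show ?case
    by (cases C) (auto simp: sign_represents_IP_def weighted_sum_def)
next
  case (Suc n)
  define V where "V = {X (Suc n), Y (Suc n)}"
  define e where "e a b = gate_at V (const_xy a b)" for a b
  have pos: "(if a \<and> b then - 1 else 1) * (- 1) ^ IP n z * weighted_sum (reweight V (e a b) C) z > 0"
    for a b z
  proof -
    have "(- 1) ^ IP (Suc n) (override_on z (const_xy a b) V)
        * weighted_sum C (override_on z (const_xy a b) V) > 0"
      using Suc.prems by (simp only: sign_represents_IP_def)
    then show ?thesis
      unfolding V_def e_def IP_Suc_override_on weighted_sum_override_on .
  qed
  have pos': "(- 1) ^ IP n z * weighted_sum (reweight V (e a b) C) z > 0" if "\<not> (a \<and> b)" for a b z
    using pos[of a b z] that by auto
  have "sign_represents_IP n (reweight V (e a b) C)" if "\<not> (a \<and> b)" for a b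
    using pos' that by (simp add: sign_represents_IP_def)
  \<comment> \<open>At 11 the new pair flips the parity, so subtracting that restriction adds a term
    of the right sign.\<close>
  moreover have "sign_represents_IP n (reweight V (\<lambda>L. e a b L - e True True L) C)"
    if "\<not> (a \<and> b)" for a b
    unfolding sign_represents_IP_def
  proof
    fix z
    show "(- 1) ^ IP n z * weighted_sum (reweight V (\<lambda>L. e a b L - e True True L) C) z > 0"
      using pos'[OF that, of z] pos[of True True z]
      by (simp add: weighted_sum_reweight_diff right_diff_distrib)
  qed
  ultimately have
    "2 ^ n \<le> length (reweight V (e False True) C)"
    "2 ^ n \<le> length (reweight V (e True False) C)"
    "2 ^ n \<le> length (reweight V (\<lambda>L. e False True L - e True True L) C)"
    "2 ^ n \<le> length (reweight V (\<lambda>L. e True False L - e True True L) C)"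
    by (simp_all add: Suc.IH)
  with length_reweight_sum_le[of V C] show ?case
    unfolding e_def by simp
qed

theorem theorem6p7:
  fixes n :: nat and C :: "xy_var threshold_of_ands"
  assumes "n \<ge> 1"
    and "is_circuit (xy_vars n) C"
    and "computes C (IP n)"
  shows "circuit_size C \<ge> 2 ^ n"
proof -
  have "(- 1) ^ IP n z * weighted_sum C z > 0" for z
  proof -
    have "weighted_sum C z \<noteq> 0"
      using assms(2) by (simp add: is_circuit_def)
    moreover have "IP n z = (if weighted_sum C z < 0 then 1 else 0)"
      using assms(3) by (metis computes_def circuit_output_def)
    ultimately show ?thesis by simp
  qed
  then show ?thesis
    using sign_represents_IP_length by (simp add: sign_represents_IP_def circuit_size_def)
qed

end
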